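(* Let $S\subset(0,+\infty)$ be countable. Then $(\mathbf{Q}_S,<^{\mathbf{Q}_S}_{lex})$ is a countable structure such that (i) its finite substructures (finite subsets with the induced metric and ordering) are, up to order-preserving isometry, exactly the elements of $\mathcal{U}^{c<}_S$; and (ii) it is ultrahomogeneous: every order-preserving isometry between finite substructures of $(\mathbf{Q}_S,<^{\mathbf{Q}_S}_{lex})$ extends to an order-preserving isometry of $\mathbf{Q}_S$ onto itself.
   Context: $\mathbf{Q}_S$ is the set of finitely supported functions $x:S\to\mathbb{Q}$ with the ultrametric $d(x,y)=\min\{s\in S:\forall t\in S\,(s<t\Rightarrow x(t)=y(t))\}$ for $x\neq y$, $d(x,x)=0$. The lexicographical ordering $<^{\mathbf{Q}_S}_{lex}$ is defined for $x\neq y$ by $x<y$ iff $x(s)<y(s)$ where $s=d(x,y)$ (the largest element of $S$ at which $x$ and $y$ differ). A linear ordering of an ultrametric space is convex if every metric ball is convex with respect to it. $\mathcal{U}^{c<}_S$ is the class of finite ultrametric spaces with all nonzero distances in $S$, equipped with a convex linear ordering. *)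

theory Defs
  imports "HOL-Analysis.Analysis"
begin

locale ultrametric_space = Metric_space X d
  for X :: "'a set" and d :: "'a \<Rightarrow> 'a \<Rightarrow> real" +
  assumes ultra: "\<lbrakk>x \<in> X; y \<in> X; z \<in> X\<rbrakk> \<Longrightarrow> d x z \<le> max (d x y) (d y z)"

text \<open>
  The order is a strict order, required to be linear only on \<open>X\<close>. Consequently a subset
  \<open>F\<close> of \<open>X\<close> carries its induced metric and ordering simply as \<open>F\<close> with the same
  \<open>d\<close> and \<open>\<sqsubset>\<close>.
\<close>

locale ordered_ultrametric_space = ultrametric_space X d
  for X :: "'a set" and d :: "'a \<Rightarrow> 'a \<Rightarrow> real"
    and lt :: "'a \<Rightarrow> 'a \<Rightarrow> bool" (infix "\<sqsubset>" 50) +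
  assumes irrefl: "irreflp_on X (\<sqsubset>)"
    and trans: "transp_on X (\<sqsubset>)"
    and total: "totalp_on X (\<sqsubset>)"
begin

definition order_convex :: "'a set \<Rightarrow> bool" where
  "order_convex B \<longleftrightarrow> (\<forall>a\<in>B. \<forall>b\<in>B. \<forall>c\<in>X. a \<sqsubset> c \<and> c \<sqsubset> b \<longrightarrow> c \<in> B)"

end

locale convexly_ordered_ultrametric_space = ordered_ultrametric_space X d lt
  for X :: "'a set" and d :: "'a \<Rightarrow> 'a \<Rightarrow> real" and lt :: "'a \<Rightarrow> 'a \<Rightarrow> bool" +
  assumes mball_convex: "order_convex (mball x r)"
    and mcball_convex: "order_convex (mcball x r)"

definition in_Uc :: "real set \<Rightarrow> 'a set \<Rightarrow> ('a \<Rightarrow> 'a \<Rightarrow> real) \<Rightarrow> ('a \<Rightarrow> 'a \<Rightarrow> bool) \<Rightarrow> bool" where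
  "in_Uc S X d lt \<longleftrightarrow>
     convexly_ordered_ultrametric_space X d lt \<and> finite X \<and>
     (\<forall>x\<in>X. \<forall>y\<in>X. d x y \<noteq> 0 \<longrightarrow> d x y \<in> S)"

definition order_isometry ::
  "'a set \<Rightarrow> ('a \<Rightarrow> 'a \<Rightarrow> real) \<Rightarrow> ('a \<Rightarrow> 'a \<Rightarrow> bool) \<Rightarrow>
   'b set \<Rightarrow> ('b \<Rightarrow> 'b \<Rightarrow> real) \<Rightarrow> ('b \<Rightarrow> 'b \<Rightarrow> bool) \<Rightarrow> ('a \<Rightarrow> 'b) \<Rightarrow> bool" where
  "order_isometry X d lt X' d' lt' f \<longleftrightarrow>
     bij_betw f X X' \<and>
     (\<forall>x\<in>X. \<forall>y\<in>X. d' (f x) (f y) = d x y) \<and>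
     (\<forall>x\<in>X. \<forall>y\<in>X. lt' (f x) (f y) \<longleftrightarrow> lt x y)"

definition ultrahomogeneous ::
  "'a set \<Rightarrow> ('a \<Rightarrow> 'a \<Rightarrow> real) \<Rightarrow> ('a \<Rightarrow> 'a \<Rightarrow> bool) \<Rightarrow> bool" where
  "ultrahomogeneous X d lt \<longleftrightarrow>
     (\<forall>F G f. F \<subseteq> X \<and> finite F \<and> G \<subseteq> X \<and> finite G \<and> order_isometry F d lt G d lt f \<longrightarrow>
        (\<exists>g. order_isometry X d lt X d lt g \<and> (\<forall>x\<in>F. g x = f x)))"

text \<open>Functions from \<open>S\<close> to the rationals are \<open>undefined\<close> outside \<open>S\<close>.\<close>

definition QS :: "real set \<Rightarrow> (real \<Rightarrow> rat) set" where
  "QS S = {x \<in> S \<rightarrow>\<^sub>E UNIV. finite {s \<in> S. x s \<noteq> 0}}"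

text \<open>
  For distinct \<open>x\<close>, \<open>y\<close> in \<open>QS S\<close> the least element below is attained: it is the largest
  point of the finite nonempty set where they differ. The value 0 off \<open>QS S\<close> is there because
  \<^locale>\<open>Metric_space\<close> requires nonnegativity on the whole type.
\<close>

definition QS_dist :: "real set \<Rightarrow> (real \<Rightarrow> rat) \<Rightarrow> (real \<Rightarrow> rat) \<Rightarrow> real" where
  "QS_dist S x y =
     (if x \<in> QS S \<and> y \<in> QS S \<and> x \<noteq> y
      then (LEAST s. s \<in> S \<and> (\<forall>t\<in>S. s < t \<longrightarrow> x t = y t))
      else 0)"

definition QS_lex :: "real set \<Rightarrow> (real \<Rightarrow> rat) \<Rightarrow> (real \<Rightarrow> rat) \<Rightarrow> bool" where
  "QS_lex S x y \<longleftrightarrow> x \<noteq> y \<and> x (QS_dist S x y) < y (QS_dist S x y)"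

end

theory Submission
  imports Defs
begin

text \<open>
  Universality is proved by adding one point at a time: if \<open>q\<close> is a nearest point to the new
  point \<open>p\<close>, at distance \<open>\<delta>\<close>, the image of \<open>p\<close> is the image of \<open>q\<close> with its coordinate at
  \<open>\<delta>\<close> replaced by a rational in the cut prescribed by the order; convexity makes this cut
  nonempty.

  Ultrahomogeneity needs no back-and-forth argument. By induction it suffices to find an
  automorphism that maps \<open>a\<close> to \<open>b\<close> and fixes a finite set over which \<open>a\<close> and \<open>b\<close> have the same
  type. With \<open>r\<close> the distance of \<open>a\<close> and \<open>b\<close>, such a map is given explicitly: on the closed ball
  of radius \<open>r\<close> around \<open>a\<close> apply a piecewise linear bijection of the rationals to the coordinate
  at \<open>r\<close>, and translate by \<open>b - a\<close> the coordinates below \<open>r\<close> of the points that agree with \<open>a\<close>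
  at \<open>r\<close>; elsewhere do nothing.
\<close>

section \<open>Finite cuts in a dense linear order\<close>

text \<open>Density supplies a point between \<open>Max A\<close> and \<open>Min B\<close>; the
  absence of endpoints covers the cases where a set is empty. Every rational that must fill a finite
  cut comes from here.\<close>

lemma finite_sets_separated:
  fixes A B :: "'a :: {unbounded_dense_linorder} set"
  assumes "finite A" "finite B" "\<And>a b. a \<in> A \<Longrightarrow> b \<in> B \<Longrightarrow> a < b"
  obtains c where "\<And>a. a \<in> A \<Longrightarrow> a < c" "\<And>b. b \<in> B \<Longrightarrow> c < b"
proof -
  have "\<exists>c. (\<forall>a\<in>A. a < c) \<and> (\<forall>b\<in>B. c < b)"
  proof (cases "A = {}")
    case True
    show ?thesis
    proof (cases "B = {}")
      case False
      obtain c where "c < Min B" using lt_ex by blast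
      then show ?thesis using True False assms(2) by auto
    qed (use True in auto)
  next
    case A: False
    show ?thesis
    proof (cases "B = {}")
      case True
      obtain c where "Max A < c" using gt_ex by blast
      then show ?thesis using True A assms(1) by auto
    next
      case False
      then have "Max A < Min B" using A assms by simp
      then obtain c where "Max A < c" "c < Min B" using dense by blast
      then show ?thesis using False A assms(1,2) by auto
    qed
  qed
  then show ?thesis using that by blast
qed

text \<open>For \<open>l < a < u\<close> and \<open>l < b < u\<close> this maps
  \<open>[l, a]\<close> linearly onto \<open>[l, b]\<close> and \<open>[a, u]\<close> linearly onto
  \<open>[b, u]\<close>. Exchanging \<open>a\<close> and \<open>b\<close> inverts both
  slopes.\<close>

definition bump :: "rat \<Rightarrow> rat \<Rightarrow> rat \<Rightarrow> rat \<Rightarrow> rat \<Rightarrow> rat" where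
  "bump l u a b x =
     (if x \<le> l \<or> u \<le> x then x
      else if x \<le> a then l + (x - l) * ((b - l) / (a - l))
      else u - (u - x) * ((u - b) / (u - a)))"

lemma bump_at: "l < a \<Longrightarrow> a < u \<Longrightarrow> bump l u a b a = b"
  by (simp add: bump_def)

text \<open>Each linear piece is undone by the piece of reciprocal slope. The work is to see that
  \<open>(l, a]\<close> lands in \<open>(l, b]\<close> and \<open>(a, u)\<close> in
  \<open>(b, u)\<close>, so that the outer map selects the matching branch.\<close>

lemma bump_inverse:
  assumes "l < a" "a < u" "l < b" "b < u"
  shows "bump l u b a (bump l u a b x) = x"
proof -
  consider "x \<le> l \<or> u \<le> x" | "l < x" "x \<le> a" | "a < x" "x < u" by fastforce
  then show ?thesis
  proof cases
    case 1
    then show ?thesis by (auto simp: bump_def)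
  next
    case 2
    define y where "y = l + (x - l) * ((b - l) / (a - l))"
    have "(x - l) * ((b - l) / (a - l)) > 0"
      using assms 2 by (intro mult_pos_pos divide_pos_pos) auto
    then have "l < y" by (simp add: y_def)
    have "(x - l) * ((b - l) / (a - l)) \<le> (a - l) * ((b - l) / (a - l))"
      using assms 2 by (intro mult_right_mono) auto
    then have "y \<le> b" using assms by (simp add: y_def)
    have "bump l u a b x = y" using 2 assms by (simp add: bump_def y_def)
    moreover have "bump l u b a y = l + (y - l) * ((a - l) / (b - l))"
      using \<open>l < y\<close> \<open>y \<le> b\<close> assms by (simp add: bump_def)
    moreover have "(y - l) * ((a - l) / (b - l)) = x - l"
      using assms by (simp add: y_def)
    ultimately show ?thesis by simp
  next
    case 3
    define y where "y = u - (u - x) * ((u - b) / (u - a))"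
    have "(u - x) * ((u - b) / (u - a)) > 0"
      using assms 3 by (intro mult_pos_pos divide_pos_pos) auto
    then have "y < u" by (simp add: y_def)
    have "(u - x) * ((u - b) / (u - a)) < (u - a) * ((u - b) / (u - a))"
      using assms 3 by (intro mult_strict_right_mono) auto
    then have "b < y" using assms by (simp add: y_def)
    have "bump l u a b x = y" using 3 assms by (simp add: bump_def y_def)
    moreover have "bump l u b a y = u - (u - y) * ((u - a) / (u - b))"
      using \<open>y < u\<close> \<open>b < y\<close> assms by (simp add: bump_def)
    moreover have "(u - y) * ((u - a) / (u - b)) = u - x"
      using assms by (simp add: y_def)
    ultimately show ?thesis by simp
  qed
qed

text \<open>Both slopes are positive and neighbouring branches agree at \<open>l\<close>,
  \<open>a\<close> and \<open>u\<close>; the ranges of the branches settle pairs taken from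
  different branches.\<close>

lemma strict_mono_bump:
  assumes "l < a" "a < u" "l < b" "b < u"
  shows "strict_mono (bump l u a b)"
proof (rule strict_monoI)
  fix x y :: rat assume "x < y"
  define f where "f z = l + (z - l) * ((b - l) / (a - l))" for z
  define g where "g z = u - (u - z) * ((u - b) / (u - a))" for z
  have slopes: "(b - l) / (a - l) > 0" "(u - b) / (u - a) > 0"
    using assms by simp_all
  have f: "f z < f w" and g: "g z < g w" if "z < w" for z w
    using mult_strict_right_mono[OF _ slopes(1), of "z - l" "w - l"]
      mult_strict_right_mono[OF _ slopes(2), of "u - w" "u - z"] that
    by (simp_all add: f_def g_def del: times_divide_eq_right)
  have ends: "f l = l" "f a = b" "g a = b" "g u = u"
    using assms by (simp_all add: f_def g_def)
  have bump: "bump l u a b z = (if z \<le> l \<or> u \<le> z then z else if z \<le> a then f z else g z)" for z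
    by (simp add: bump_def f_def g_def)
  have f_range: "l < f z" "f z \<le> b" if "l < z" "z \<le> a" for z
    using f[of l z] f[of z a] ends that by (auto simp: order_le_less)
  have g_range: "b < g z" "g z < u" if "a < z" "z < u" for z
    using g[of a z] g[of z u] ends that by auto
  show "bump l u a b x < bump l u a b y"
    using \<open>x < y\<close> assms f[of x y] g[of x y] f_range[of x] f_range[of y] g_range[of x] g_range[of y]
    unfolding bump by (auto simp: not_le)
qed

text \<open>No point of \<open>P\<close> separates \<open>a\<close> from \<open>b\<close>, so some
  interval \<open>(l, u)\<close> contains both and misses \<open>P\<close>; \<open>bump\<close>
  moves only points of that interval.\<close>

lemma rat_automorphism_fixing:
  fixes a b :: rat
  assumes "finite P" "a \<notin> P" "b \<notin> P" "\<And>p. p \<in> P \<Longrightarrow> p < a \<longleftrightarrow> p < b"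
  obtains \<phi> \<psi> where "strict_mono \<phi>" "strict_mono \<psi>" "\<And>x. \<psi> (\<phi> x) = x" "\<And>x. \<phi> (\<psi> x) = x"
    "\<phi> a = b" "\<And>p. p \<in> P \<Longrightarrow> \<phi> p = p"
proof -
  obtain l where l: "\<And>p. p \<in> {p \<in> P. p < a} \<Longrightarrow> p < l" "\<And>x. x \<in> {a, b} \<Longrightarrow> l < x"
    by (rule finite_sets_separated[of "{p \<in> P. p < a}" "{a, b}"]) (use assms in auto)
  \<comment> \<open>\<open>a\<close> and \<open>b\<close> are not in \<open>P\<close>, so a point of
    \<open>P\<close> that is not below \<open>a\<close> lies strictly above \<open>a\<close>, hence
    also strictly above \<open>b\<close>.\<close>
  have gt: "p > a" "p > b" if "p \<in> {p \<in> P. \<not> p < a}" for p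
    using that assms(2-4) by (metis linorder_cases mem_Collect_eq)+
  obtain u where u: "\<And>x. x \<in> {a, b} \<Longrightarrow> x < u" "\<And>p. p \<in> {p \<in> P. \<not> p < a} \<Longrightarrow> u < p"
    by (rule finite_sets_separated[of "{a, b}" "{p \<in> P. \<not> p < a}"]) (use assms(1) gt in auto)
  have lu: "l < a" "a < u" "l < b" "b < u" using l u by auto
  show ?thesis
  proof (rule that[of "bump l u a b" "bump l u b a"])
    show "bump l u a b p = p" if "p \<in> P" for p
      using l(1)[of p] u(2)[of p] that by (cases "p < a") (auto simp: bump_def)
  qed (use lu in \<open>auto intro: strict_mono_bump bump_inverse bump_at\<close>)
qed

section \<open>The lexicographic ultrametric space\<close>

lemma QS_ext: "x \<in> QS S \<Longrightarrow> y \<in> QS S \<Longrightarrow> (\<And>s. s \<in> S \<Longrightarrow> x s = y s) \<Longrightarrow> x = y"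
  unfolding QS_def by (auto intro: PiE_ext)

lemma QS_outside: "x \<in> QS S \<Longrightarrow> s \<notin> S \<Longrightarrow> x s = undefined"
  unfolding QS_def by auto

lemma QS_finite: "x \<in> QS S \<Longrightarrow> finite {s \<in> S. x s \<noteq> 0}"
  unfolding QS_def by auto

lemma QS_I:
  assumes "\<And>s. s \<notin> S \<Longrightarrow> x s = undefined" "finite A" "\<And>s. s \<in> S \<Longrightarrow> x s \<noteq> 0 \<Longrightarrow> s \<in> A"
  shows "x \<in> QS S"
proof -
  have "{s \<in> S. x s \<noteq> 0} \<subseteq> A" using assms(3) by auto
  then show ?thesis using assms(1,2) finite_subset unfolding QS_def by auto
qed

lemma countable_QS:
  assumes "countable S"
  shows "countable (QS S)"
proof -
  \<comment> \<open>The graph of a point over its support is a finite subset of a countable set, and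
    it determines the point.\<close>
  define supp where "supp x = {(s, x s) |s. s \<in> S \<and> x s \<noteq> 0}" for x :: "real \<Rightarrow> rat"
  have "inj_on supp (QS S)"
  proof (intro inj_onI QS_ext)
    fix x y s assume "supp x = supp y" "s \<in> S"
    then have "(s, v) \<in> supp x \<longleftrightarrow> (s, v) \<in> supp y" for v by simp
    then show "x s = y s" unfolding supp_def using \<open>s \<in> S\<close> by (cases "x s = 0") force+
  qed auto
  moreover have "supp ` QS S \<subseteq> {A. finite A \<and> A \<subseteq> S \<times> UNIV}"
  proof
    fix A assume "A \<in> supp ` QS S"
    then obtain x where x: "x \<in> QS S" "A = supp x" by auto
    have "A = (\<lambda>s. (s, x s)) ` {s \<in> S. x s \<noteq> 0}" unfolding x supp_def by auto
    then show "A \<in> {A. finite A \<and> A \<subseteq> S \<times> UNIV}" using QS_finite[OF x(1)] by auto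
  qed
  moreover have "countable {A. finite A \<and> A \<subseteq> S \<times> (UNIV :: rat set)}"
    using assms by (intro countable_Collect_finite_subset) auto
  ultimately show ?thesis
    using countable_image_inj_on[of supp "QS S"] countable_subset[of "supp ` QS S"] by blast
qed

text \<open>For points of \<open>QS S\<close> this says that their distance is \<open>s\<close> and
  that \<open>x\<close> is the smaller one. A single relation thus carries metric and order
  together, without the \<open>LEAST\<close> of \<open>QS_dist\<close>.\<close>

definition lex_at :: "real set \<Rightarrow> real \<Rightarrow> (real \<Rightarrow> rat) \<Rightarrow> (real \<Rightarrow> rat) \<Rightarrow> bool" where
  "lex_at S s x y \<longleftrightarrow> s \<in> S \<and> x s < y s \<and> (\<forall>t\<in>S. s < t \<longrightarrow> x t = y t)"

lemma QS_dist_eqI: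
  assumes "x \<in> QS S" "y \<in> QS S" "s \<in> S" "x s \<noteq> y s" "\<And>t. t \<in> S \<Longrightarrow> s < t \<Longrightarrow> x t = y t"
  shows "QS_dist S x y = s"
proof -
  \<comment> \<open>An index below \<open>s\<close> cannot qualify, as it would force
    \<open>x s = y s\<close>.\<close>
  have "(LEAST s. s \<in> S \<and> (\<forall>t\<in>S. s < t \<longrightarrow> x t = y t)) = s"
    using assms(3-5) by (intro Least_equality) (blast, meson not_less)
  then show ?thesis using assms(1,2,4) by (auto simp: QS_dist_def)
qed

lemma QS_dist_self [simp]: "QS_dist S x x = 0"
  by (simp add: QS_dist_def)

lemma QS_dist_commute: "QS_dist S x y = QS_dist S y x"
proof -
  have "(\<forall>t\<in>S. s < t \<longrightarrow> x t = y t) \<longleftrightarrow> (\<forall>t\<in>S. s < t \<longrightarrow> y t = x t)" for s by metis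
  then show ?thesis unfolding QS_dist_def by auto
qed

lemma lex_at_dist:
  assumes "x \<in> QS S" "y \<in> QS S" "lex_at S s x y"
  shows "QS_dist S x y = s" "QS_dist S y x = s"
proof -
  show "QS_dist S x y = s"
    using assms by (intro QS_dist_eqI) (auto simp: lex_at_def)
  then show "QS_dist S y x = s" by (metis QS_dist_commute)
qed

lemma lex_at_lex:
  assumes "x \<in> QS S" "y \<in> QS S" "lex_at S s x y"
  shows "QS_lex S x y" "\<not> QS_lex S y x"
  using assms lex_at_dist[OF assms] by (auto simp: QS_lex_def lex_at_def)

text \<open>The set where \<open>x\<close> and \<open>y\<close> differ lies in the union of two
  finite supports, so it has a maximum unless \<open>x = y\<close>; the values there decide the
  order.\<close>

lemma lex_at_cases:
  assumes x: "x \<in> QS S" and y: "y \<in> QS S"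
  obtains (eq) "x = y" | (less) s where "lex_at S s x y" | (greater) s where "lex_at S s y x"
proof (cases "x = y")
  case False
  define D where "D = {s \<in> S. x s \<noteq> y s}"
  have "D \<subseteq> {s \<in> S. x s \<noteq> 0} \<union> {s \<in> S. y s \<noteq> 0}" unfolding D_def by auto
  then have "finite D" using QS_finite[OF x] QS_finite[OF y] finite_subset by blast
  moreover have "D \<noteq> {}" using QS_ext[OF x y] False unfolding D_def by auto
  ultimately have "Max D \<in> D" "\<And>t. t \<in> D \<Longrightarrow> t \<le> Max D" by auto
  then obtain m where m: "m \<in> S" "x m \<noteq> y m" "\<And>t. t \<in> S \<Longrightarrow> m < t \<Longrightarrow> x t = y t"
    unfolding D_def by (metis (mono_tags, lifting) mem_Collect_eq not_less)
  show ?thesis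
  proof (cases "x m < y m")
    case True
    then show ?thesis using m by (intro that(2)[of m]) (simp add: lex_at_def)
  next
    case False
    then show ?thesis using m by (intro that(3)[of m]) (simp add: lex_at_def)
  qed
qed (use that in blast)

lemma QS_lex_iff:
  assumes "x \<in> QS S" "y \<in> QS S"
  shows "QS_lex S x y \<longleftrightarrow> (\<exists>s. lex_at S s x y)"
  using assms
proof (cases rule: lex_at_cases)
  case eq
  then show ?thesis by (simp add: QS_lex_def lex_at_def)
next
  case (less s)
  then show ?thesis using lex_at_lex(1)[OF assms less] by blast
next
  case (greater s)
  then show ?thesis using lex_at_lex(2)[OF assms(2,1) greater] lex_at_lex(1)[OF assms] by blast
qed

text \<open>At the larger index one pair still differs strictly while the other agrees or differs in
  the same direction. This yields transitivity of the order and also convexity, since for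
  \<open>x\<close>, \<open>y\<close>, \<open>z\<close> in increasing order the outer distance is the
  maximum of the inner two.\<close>

lemma lex_at_trans: "lex_at S s x y \<Longrightarrow> lex_at S t y z \<Longrightarrow> lex_at S (max s t) x z"
  unfolding lex_at_def by (cases s t rule: linorder_cases) (auto simp: max_def)

text \<open>One direction suffices: by trichotomy each pair is equal or related by
  \<open>lex_at\<close> one way, and the image pair then has the same distance and order, so
  injectivity and the converse follow.\<close>

lemma order_isometry_QSI:
  assumes "f ` F \<subseteq> QS S"
    and "F \<subseteq> QS S"
    and L: "\<And>x y s. x \<in> F \<Longrightarrow> y \<in> F \<Longrightarrow> lex_at S s x y \<Longrightarrow> lex_at S s (f x) (f y)"
  shows "order_isometry F (QS_dist S) (QS_lex S) (f ` F) (QS_dist S) (QS_lex S) f"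
proof -
  have *: "QS_dist S (f x) (f y) = QS_dist S x y \<and> (QS_lex S (f x) (f y) \<longleftrightarrow> QS_lex S x y)
      \<and> (f x = f y \<longrightarrow> x = y)"
    if "x \<in> F" "y \<in> F" for x y
  proof -
    have QS: "x \<in> QS S" "y \<in> QS S" "f x \<in> QS S" "f y \<in> QS S" using that assms(1,2) by auto
    from QS(1,2) show ?thesis
    proof (cases rule: lex_at_cases)
      case eq
      then show ?thesis by (simp add: QS_lex_def)
    next
      case (less s)
      then have "lex_at S s (f x) (f y)" using L that by blast
      then show ?thesis using less QS lex_at_dist lex_at_lex by (metis QS_lex_def)
    next
      case (greater s)
      then have "lex_at S s (f y) (f x)" using L that by blast
      then show ?thesis using greater QS lex_at_dist lex_at_lex by (metis QS_lex_def)
    qed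
  qed
  then show ?thesis unfolding order_isometry_def bij_betw_def inj_on_def by blast
qed

lemma order_isometry_trans:
  assumes "order_isometry X d lt Y d' lt' f" "order_isometry Y d' lt' Z d'' lt'' g"
  shows "order_isometry X d lt Z d'' lt'' (g \<circ> f)"
proof -
  have "bij_betw f X Y" "bij_betw g Y Z" using assms unfolding order_isometry_def by blast+
  then have "bij_betw (g \<circ> f) X Z" "\<And>x. x \<in> X \<Longrightarrow> f x \<in> Y"
    by (auto intro: bij_betw_trans dest: bij_betwE)
  then show ?thesis using assms unfolding order_isometry_def by simp
qed

section \<open>Ultrametric and order axioms; finite subsets belong to the class\<close>

context
  fixes S :: "real set"
  assumes S_pos: "S \<subseteq> {0<..}"
begin

text \<open>Describes closed balls by agreement of coordinates above \<open>r\<close>. The bound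
  \<open>0 \<le> r\<close> matters for \<open>x = y\<close>, where the distance is 0.\<close>

lemma QS_dist_le_iff:
  assumes "x \<in> QS S" "y \<in> QS S" "0 \<le> r"
  shows "QS_dist S x y \<le> r \<longleftrightarrow> (\<forall>t\<in>S. r < t \<longrightarrow> x t = y t)"
  using assms(1,2)
proof (cases rule: lex_at_cases)
  case eq
  then show ?thesis using assms by simp
next
  case (less s)
  then show ?thesis using lex_at_dist[OF assms(1,2) less]
    unfolding lex_at_def by (metis less_irrefl not_less order_le_less_trans)
next
  case (greater s)
  then show ?thesis using lex_at_dist[OF assms(2,1) greater]
    unfolding lex_at_def by (metis less_irrefl not_less order_le_less_trans)
qed

lemma QS_dist_pos:
  assumes "x \<in> QS S" "y \<in> QS S" "x \<noteq> y"
  shows "QS_dist S x y \<in> S" "0 < QS_dist S x y"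
    "x (QS_dist S x y) \<noteq> y (QS_dist S x y)"
proof -
  have "QS_dist S x y \<in> S \<and> x (QS_dist S x y) \<noteq> y (QS_dist S x y)"
    using assms(1,2)
  proof (cases rule: lex_at_cases)
    case (less s)
    then show ?thesis using lex_at_dist(1)[OF assms(1,2) less] unfolding lex_at_def by simp
  next
    case (greater s)
    then show ?thesis using lex_at_dist(2)[OF assms(2,1) greater] unfolding lex_at_def by simp
  qed (use assms(3) in blast)
  then show "QS_dist S x y \<in> S" "0 < QS_dist S x y"
    "x (QS_dist S x y) \<noteq> y (QS_dist S x y)" using S_pos by blast+
qed

lemma QS_dist_nonneg: "0 \<le> QS_dist S x y"
proof (cases "x \<in> QS S \<and> y \<in> QS S \<and> x \<noteq> y")
  case True
  then show ?thesis by (intro less_imp_le QS_dist_pos(2)) simp_all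
next
  case False
  then show ?thesis unfolding QS_dist_def by (simp only: if_False order_refl)
qed

text \<open>Reduces to transitivity of agreement above the larger of the two distances.\<close>

lemma QS_dist_ultra:
  assumes "x \<in> QS S" "y \<in> QS S" "z \<in> QS S"
  shows "QS_dist S x z \<le> max (QS_dist S x y) (QS_dist S y z)"
proof -
  define m where "m = max (QS_dist S x y) (QS_dist S y z)"
  have m: "0 \<le> m" "QS_dist S x y \<le> m" "QS_dist S y z \<le> m"
    using QS_dist_nonneg[of x y] by (auto simp: m_def)
  then have "QS_dist S x z \<le> m"
    using assms by (simp add: QS_dist_le_iff)
  then show ?thesis by (simp add: m_def)
qed

lemma ordered_ultrametric_space_QS_subset:
  assumes "F \<subseteq> QS S"
  shows "ordered_ultrametric_space F (QS_dist S) (QS_lex S)"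
proof
  show "0 \<le> QS_dist S x y" for x y by (rule QS_dist_nonneg)
  show "QS_dist S x y = QS_dist S y x" for x y by (rule QS_dist_commute)
  show "QS_dist S x y = 0 \<longleftrightarrow> x = y" if "x \<in> F" "y \<in> F" for x y
    using QS_dist_pos(2)[of x y] subsetD[OF assms that(1)] subsetD[OF assms that(2)]
    by (cases "x = y") auto
  show u: "QS_dist S x z \<le> max (QS_dist S x y) (QS_dist S y z)"
    if "x \<in> F" "y \<in> F" "z \<in> F" for x y z
    using QS_dist_ultra that assms by blast
  show "QS_dist S x z \<le> QS_dist S x y + QS_dist S y z"
    if "x \<in> F" "y \<in> F" "z \<in> F" for x y z
    using u[OF that] QS_dist_nonneg[of x y] QS_dist_nonneg[of y z] by linarith
  show "irreflp_on F (QS_lex S)" by (simp add: irreflp_on_def QS_lex_def)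
  show "transp_on F (QS_lex S)"
  proof (rule transp_onI)
    fix x y z assume "x \<in> F" "y \<in> F" "z \<in> F" and lt: "QS_lex S x y" "QS_lex S y z"
    then have QS: "x \<in> QS S" "y \<in> QS S" "z \<in> QS S" using assms by auto
    then show "QS_lex S x z" using lt lex_at_trans by (metis QS_lex_iff)
  qed
  show "totalp_on F (QS_lex S)"
  proof (rule totalp_onI)
    fix x y assume "x \<in> F" "y \<in> F" "x \<noteq> y"
    then have QS: "x \<in> QS S" "y \<in> QS S" using assms by auto
    then show "QS_lex S x y \<or> QS_lex S y x"
      by (cases rule: lex_at_cases) (use \<open>x \<noteq> y\<close> QS QS_lex_iff in blast)+
  qed
qed

lemma in_Uc_QS_subset:
  assumes "F \<subseteq> QS S" "finite F"
  shows "in_Uc S F (QS_dist S) (QS_lex S)"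
proof -
  interpret ordered_ultrametric_space F "QS_dist S" "QS_lex S"
    by (rule ordered_ultrametric_space_QS_subset[OF assms(1)])
  \<comment> \<open>A point between \<open>a\<close> and \<open>b\<close> is no farther from any
    centre than the farther of the two, which makes open and closed balls convex at once.\<close>
  have between: "QS_dist S x c \<le> max (QS_dist S x a) (QS_dist S x b)"
    if F: "x \<in> F" "a \<in> F" "b \<in> F" "c \<in> F" and lt: "QS_lex S a c" "QS_lex S c b" for x a b c
  proof -
    have QS: "a \<in> QS S" "b \<in> QS S" "c \<in> QS S" using F assms(1) by auto
    obtain s t where st: "lex_at S s a c" "lex_at S t c b"
      using lt QS by (metis QS_lex_iff)
    then have "QS_dist S a c \<le> QS_dist S a b"
      using lex_at_trans[OF st] lex_at_dist(1) QS by (metis max.cobounded1)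
    also have "\<dots> \<le> max (QS_dist S x a) (QS_dist S x b)"
      using ultra[of a x b] F by (simp add: commute[of a x])
    finally show ?thesis using ultra[of x a c] F by linarith
  qed
  have "convexly_ordered_ultrametric_space F (QS_dist S) (QS_lex S)"
  proof
    show "order_convex (mball x r)" for x r
      unfolding order_convex_def using between by (fastforce simp: mball_def)
    show "order_convex (mcball x r)" for x r
      unfolding order_convex_def using between by (fastforce simp: mcball_def)
  qed
  moreover have "QS_dist S x y \<in> S" if "x \<in> F" "y \<in> F" "QS_dist S x y \<noteq> 0" for x y
    using QS_dist_pos(1)[of x y] that assms(1) by fastforce
  ultimately show ?thesis using assms(2) unfolding in_Uc_def by blast
qed

end

section \<open>Universality\<close>

text \<open>A ball of \<open>Y\<close> is empty or the trace on \<open>Y\<close> of a ball of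
  \<open>X\<close>, so convexity is inherited. This permits induction on the points of a
  space.\<close>

lemma in_Uc_subset:
  assumes "in_Uc S X d lt" "Y \<subseteq> X"
  shows "in_Uc S Y d lt"
proof -
  interpret X: convexly_ordered_ultrametric_space X d lt
    using assms(1) unfolding in_Uc_def by blast
  interpret Y: ordered_ultrametric_space Y d lt
  proof
    show "irreflp_on Y lt" using X.irrefl assms(2) by (rule irreflp_on_subset)
    show "transp_on Y lt" using X.trans assms(2) by (rule transp_on_subset)
    show "totalp_on Y lt" using X.total assms(2) by (rule totalp_on_subset)
  qed (use assms(2) X.triangle X.ultra X.commute in \<open>auto simp: subset_iff\<close>)
  have "Y.order_convex (Y.mball x r)" for x r
    using X.mball_convex[of x r] assms(2)
    unfolding X.order_convex_def Y.order_convex_def by (auto simp: X.mball_def Y.mball_def)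
  moreover have "Y.order_convex (Y.mcball x r)" for x r
    using X.mcball_convex[of x r] assms(2)
    unfolding X.order_convex_def Y.order_convex_def by (auto simp: X.mcball_def Y.mcball_def)
  ultimately have "convexly_ordered_ultrametric_space Y d lt" by unfold_locales auto
  then show ?thesis using assms finite_subset unfolding in_Uc_def by blast
qed


text \<open>The points nearest to \<open>p\<close> constrain the new image at the coordinate
  \<delta>. A farther point has the same distance and the same order relation to \<open>p\<close> as
  to \<open>q\<close>, so \<open>c\<close> inherits from \<open>f q\<close> the relation to its
  image.\<close>

lemma lex_at_extension:
  assumes S: "S \<subseteq> {0<..}" and Uc: "in_Uc S (insert p X) d lt"
    and p: "p \<notin> X" and X: "X \<noteq> {}"
    and fQ: "f ` X \<subseteq> QS S"
    and f: "\<And>x y. x \<in> X \<Longrightarrow> y \<in> X \<Longrightarrow> lt x y \<Longrightarrow> lex_at S (d x y) (f x) (f y)"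
  obtains c where "c \<in> QS S"
    "\<And>x. x \<in> X \<Longrightarrow> (lt p x \<and> lex_at S (d p x) c (f x)) \<or> (lt x p \<and> lex_at S (d x p) (f x) c)"
proof -
  interpret convexly_ordered_ultrametric_space "insert p X" d lt
    using Uc unfolding in_Uc_def by blast
  have fin: "finite X" and dS: "\<And>x y. x \<in> insert p X \<Longrightarrow> y \<in> insert p X \<Longrightarrow> d x y \<noteq> 0 \<Longrightarrow> d x y \<in> S"
    using Uc unfolding in_Uc_def by auto
  have tr: "lt x z" if "lt x y" "lt y z" "x \<in> insert p X" "y \<in> insert p X" "z \<in> insert p X" for x y z
    using trans that by (meson transp_onD)
  have tot: "lt x y \<or> lt y x" if "x \<noteq> y" "x \<in> insert p X" "y \<in> insert p X" for x y
    using total that unfolding totalp_on_def by blast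
  obtain q where q: "q \<in> X" "\<And>x. x \<in> X \<Longrightarrow> d p q \<le> d p x"
    using arg_min_if_finite(1)[OF fin X, of "d p"] arg_min_least[OF fin X, of _ "d p"] by blast
  define \<delta> where "\<delta> = d p q"
  have "d p q \<noteq> 0" using q p zero by auto
  then have \<delta>: "\<delta> \<in> S" "0 < \<delta>" using dS[of p q] q S unfolding \<delta>_def by auto
  have agree: "f x t = f y t" if "x \<in> X" "y \<in> X" "d x y \<le> r" "r < t" "t \<in> S" for x y r t
  proof (cases "x = y")
    case False
    then have "lt x y \<or> lt y x" using tot that(1,2) by blast
    then show ?thesis
    proof
      assume "lt x y"
      then show ?thesis using f[of x y] that unfolding lex_at_def by simp
    next
      assume "lt y x"
      then show ?thesis using f[of y x] that commute[of x y] unfolding lex_at_def by simp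
    qed
  qed auto
  define C where "C = {x \<in> X. d p x = \<delta>}"
  have Cd: "d x y \<le> \<delta>" if "x \<in> C" "y \<in> C" for x y
    using ultra[of x p y] that commute[of x p] unfolding C_def by auto
  have qC: "q \<in> C" using q unfolding C_def \<delta>_def by auto
  \<comment> \<open>If \<open>d x y\<close> were below \<delta>, the open ball of radius \<delta>
    around \<open>x\<close> would contain \<open>y\<close>, hence by convexity \<open>p\<close>,
    although \<open>d p x\<close> equals \<delta>. So \<open>f x\<close> and \<open>f y\<close> are
    compared exactly at \<delta>.\<close>
  have cut: "f x \<delta> < f y \<delta>" if "x \<in> C" "y \<in> C" "lt x p" "lt p y" for x y
  proof -
    have xy: "x \<in> X" "y \<in> X" using that unfolding C_def by auto
    have "\<not> d x y < \<delta>"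
    proof
      assume "d x y < \<delta>"
      then have "x \<in> mball x \<delta>" "y \<in> mball x \<delta>" using xy \<delta> by (auto simp: mball_def)
      then have "p \<in> mball x \<delta>"
        using mball_convex[of x \<delta>] that unfolding order_convex_def by blast
      then show False using that(1) commute[of x p] unfolding C_def by (auto simp: mball_def)
    qed
    then have "d x y = \<delta>" using Cd that by force
    moreover have "lt x y" using tr[of x p y] that xy by auto
    ultimately show ?thesis using f[of x y] xy by (simp add: lex_at_def)
  qed
  obtain c0 where "\<And>v. v \<in> (\<lambda>x. f x \<delta>) ` {x \<in> C. lt x p} \<Longrightarrow> v < c0"
    "\<And>v. v \<in> (\<lambda>x. f x \<delta>) ` {x \<in> C. lt p x} \<Longrightarrow> c0 < v"
  proof (rule finite_sets_separated[of "(\<lambda>x. f x \<delta>) ` {x \<in> C. lt x p}"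
        "(\<lambda>x. f x \<delta>) ` {x \<in> C. lt p x}"])
    show "finite ((\<lambda>x. f x \<delta>) ` {x \<in> C. lt x p})" "finite ((\<lambda>x. f x \<delta>) ` {x \<in> C. lt p x})"
      using fin unfolding C_def by auto
  qed (use cut in auto)
  then have c0: "\<And>x. x \<in> C \<Longrightarrow> lt x p \<Longrightarrow> f x \<delta> < c0" "\<And>x. x \<in> C \<Longrightarrow> lt p x \<Longrightarrow> c0 < f x \<delta>"
    by simp_all
  \<comment> \<open>Images of points of \<open>C\<close> all agree above \<delta>, so
    \<open>f q\<close> supplies these coordinates; \<open>c0\<close> fills the cut at
    \<delta>.\<close>
  define c where "c = (f q)(\<delta> := c0)"
  have "f q \<in> QS S" using fQ q by auto
  then have "c \<in> QS S"
    by (intro QS_I[where A = "insert \<delta> {s \<in> S. f q s \<noteq> 0}"])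
      (use \<delta> QS_outside QS_finite in \<open>auto simp: c_def split: if_splits\<close>)
  moreover have "(lt p x \<and> lex_at S (d p x) c (f x)) \<or> (lt x p \<and> lex_at S (d x p) (f x) c)"
    if x: "x \<in> X" for x
  proof (cases "x \<in> C")
    case True
    then have ag: "f x t = c t" if "\<delta> < t" "t \<in> S" for t
      using agree[OF x q(1) Cd[OF True qC] that] that by (simp add: c_def)
    have d: "d p x = \<delta>" "d x p = \<delta>" using True commute[of p x] unfolding C_def by auto
    have "lt p x \<or> lt x p" using tot[of p x] x p by auto
    then show ?thesis
    proof
      assume "lt p x"
      then show ?thesis using ag c0(2)[OF True] \<delta> unfolding d lex_at_def by (auto simp: c_def)
    next
      assume "lt x p"
      then show ?thesis using ag c0(1)[OF True] \<delta> unfolding d lex_at_def by (auto simp: c_def)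
    qed
  next
    case False
    then have gt: "\<delta> < d p x" using q(2)[OF x] x unfolding C_def \<delta>_def by auto
    \<comment> \<open>As \<open>d p q\<close> is smaller than \<open>d p x\<close>, the triangle is
      isosceles: \<open>p\<close> and \<open>q\<close> are equally far from
      \<open>x\<close>.\<close>
    have "d p x \<le> max \<delta> (d q x)" "d q x \<le> max \<delta> (d p x)"
      using ultra[of p q x] ultra[of q p x] x q commute[of p q] unfolding \<delta>_def by auto
    then have dq: "d p x = d q x" "d x p = d x q"
      using gt commute[of p x] commute[of q x] by auto
    \<comment> \<open>The closed ball contains \<open>p\<close> and \<open>q\<close> but not
      \<open>x\<close>, so by convexity \<open>x\<close> is not between them.\<close>
    have ball: "p \<in> mcball q \<delta>" "q \<in> mcball q \<delta>" "x \<notin> mcball q \<delta>"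
      using q(1) x \<delta> gt dq commute[of p q] unfolding \<delta>_def by (auto simp: mcball_def)
    then have nb: "\<not> (lt p x \<and> lt x q)" "\<not> (lt q x \<and> lt x p)"
      using mcball_convex[of q \<delta>] x unfolding order_convex_def by blast+
    have "x \<noteq> q" using ball by auto
    then have "lt q x \<or> lt x q" using tot[of q x] x q by auto
    moreover have "lt p x \<or> lt x p" using tot[of p x] x p by auto
    ultimately consider "lt p x" "lt q x" | "lt x p" "lt x q" using nb by blast
    then show ?thesis
    proof cases
      case 1
      then show ?thesis using f[of q x] x q gt unfolding dq by (auto simp: lex_at_def c_def)
    next
      case 2
      then show ?thesis using f[of x q] x q gt commute[of x q] dq by (auto simp: lex_at_def c_def)
    qed
  qed
  ultimately show ?thesis by (rule that)
qed

lemma lex_at_embedding: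
  assumes "S \<subseteq> {0<..}" "in_Uc S X d lt"
  shows "\<exists>f. f ` X \<subseteq> QS S \<and> (\<forall>x\<in>X. \<forall>y\<in>X. lt x y \<longrightarrow> lex_at S (d x y) (f x) (f y))"
proof -
  have "finite X" using assms(2) unfolding in_Uc_def by blast
  then show ?thesis using assms(2)
  proof (induction X rule: finite_induct)
    case empty
    then show ?case by simp
  next
    case (insert p X)
    interpret convexly_ordered_ultrametric_space "insert p X" d lt
      using insert.prems unfolding in_Uc_def by blast
    have irr: "\<not> lt p p" using irrefl by (meson irreflp_onD insertI1)
    have asym: "\<not> (lt p x \<and> lt x p)" if "x \<in> X" for x
      using irr trans that by (meson insertCI transp_onD)
    show ?case
    proof (cases "X = {}")
      case True
      \<comment> \<open>A first point has no nearest neighbour to copy; it is sent to the zero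
        function.\<close>
      have "(\<lambda>s. if s \<in> S then 0 else undefined) \<in> QS S"
        by (rule QS_I[where A = "{}"]) auto
      then show ?thesis using True irr by auto
    next
      case False
      obtain f where f: "f ` X \<subseteq> QS S"
        "\<And>x y. x \<in> X \<Longrightarrow> y \<in> X \<Longrightarrow> lt x y \<Longrightarrow> lex_at S (d x y) (f x) (f y)"
        using insert.IH in_Uc_subset[OF insert.prems] by blast
      obtain c where c: "c \<in> QS S"
        "\<And>x. x \<in> X \<Longrightarrow> (lt p x \<and> lex_at S (d p x) c (f x)) \<or> (lt x p \<and> lex_at S (d x p) (f x) c)"
        using lex_at_extension[OF assms(1) insert.prems insert.hyps(2) False f] by blast
      have "lex_at S (d x y) ((f(p := c)) x) ((f(p := c)) y)"
        if xy: "x \<in> insert p X" "y \<in> insert p X" "lt x y" for x y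
        using xy f(2)[of x y] c(2)[of x] c(2)[of y] irr asym[of x] asym[of y] insert.hyps(2)
        by (cases "x = p"; cases "y = p") auto
      moreover have "f(p := c) ` insert p X \<subseteq> QS S"
        using f(1) c(1) by auto
      ultimately show ?thesis by blast
    qed
  qed
qed

lemma universal_QS:
  assumes "S \<subseteq> {0<..}" "in_Uc S X d lt"
  shows "\<exists>F f. F \<subseteq> QS S \<and> finite F \<and> order_isometry X d lt F (QS_dist S) (QS_lex S) f"
proof -
  interpret convexly_ordered_ultrametric_space X d lt
    using assms(2) unfolding in_Uc_def by blast
  obtain f where fQ: "f ` X \<subseteq> QS S"
    and f: "\<And>x y. x \<in> X \<Longrightarrow> y \<in> X \<Longrightarrow> lt x y \<Longrightarrow> lex_at S (d x y) (f x) (f y)"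
    using lex_at_embedding[OF assms] by blast
  \<comment> \<open>The order is total, so \<open>lex_at\<close> on increasing pairs already
    controls every pair of distinct points.\<close>
  have *: "QS_dist S (f x) (f y) = d x y \<and> (QS_lex S (f x) (f y) \<longleftrightarrow> lt x y) \<and> (f x = f y \<longrightarrow> x = y)"
    if xy: "x \<in> X" "y \<in> X" for x y
  proof -
    have QS: "f x \<in> QS S" "f y \<in> QS S" using fQ xy by auto
    have irr: "\<not> lt x x" using irrefl xy by (meson irreflp_onD)
    have asym: "\<not> (lt x y \<and> lt y x)" using irr trans xy by (meson transp_onD)
    consider "x = y" | "lt x y" | "lt y x" using total xy unfolding totalp_on_def by blast
    then show ?thesis
    proof cases
      case 1
      then show ?thesis using xy irr by (simp add: QS_lex_def)
    next
      case 2
      note L = f[OF xy 2]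
      show ?thesis using lex_at_dist[OF QS L] lex_at_lex[OF QS L] 2 by (auto simp: QS_lex_def)
    next
      case 3
      note L = f[OF xy(2,1) 3]
      show ?thesis
        using lex_at_dist[OF QS(2,1) L] lex_at_lex[OF QS(2,1) L] 3 asym commute[of x y]
        by (auto simp: QS_lex_def)
    qed
  qed
  have "order_isometry X d lt (f ` X) (QS_dist S) (QS_lex S) f"
    unfolding order_isometry_def bij_betw_def inj_on_def using * by blast
  moreover have "finite X" using assms(2) unfolding in_Uc_def by blast
  ultimately show ?thesis using fQ by blast
qed

section \<open>Ultrahomogeneity\<close>

text \<open>The outer condition is the closed ball of radius \<open>r\<close> around
  \<open>a\<close>. The translation is restricted to the smaller ball where
  \<open>x r = a r\<close>, so that \<open>a\<close> itself goes to \<open>b\<close> when they agree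
  above \<open>r\<close> and \<open>\<phi> (a r) = b r\<close>.\<close>

definition ball_shift ::
  "real set \<Rightarrow> (real \<Rightarrow> rat) \<Rightarrow> (real \<Rightarrow> rat) \<Rightarrow> real \<Rightarrow> (rat \<Rightarrow> rat) \<Rightarrow> (real \<Rightarrow> rat) \<Rightarrow> real \<Rightarrow> rat" where
  "ball_shift S a b r \<phi> x =
     (if \<forall>t\<in>S. r < t \<longrightarrow> x t = a t
      then \<lambda>s. if s \<in> S
               then if r < s then x s
                    else if s = r then \<phi> (x r)
                    else if x r = a r then x s + (b s - a s) else x s
               else undefined
      else x)"

lemma ball_shift_outside: "\<not> (\<forall>t\<in>S. r < t \<longrightarrow> x t = a t) \<Longrightarrow> ball_shift S a b r \<phi> x = x"
  unfolding ball_shift_def by (rule if_not_P)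

lemma ball_shift_in_QS:
  assumes "x \<in> QS S" "a \<in> QS S" "b \<in> QS S"
  shows "ball_shift S a b r \<phi> x \<in> QS S"
proof (rule QS_I)
  let ?A = "insert r ({s \<in> S. x s \<noteq> 0} \<union> {s \<in> S. a s \<noteq> 0} \<union> {s \<in> S. b s \<noteq> 0})"
  show "finite ?A" using assms QS_finite by auto
  show "s \<in> ?A" if "s \<in> S" "ball_shift S a b r \<phi> x s \<noteq> 0" for s
    using that by (auto simp: ball_shift_def split: if_splits)
  show "ball_shift S a b r \<phi> x s = undefined" if "s \<notin> S" for s
    using that QS_outside[OF assms(1)] by (auto simp: ball_shift_def)
qed

text \<open>Coordinates above \<open>r\<close> never change. At \<open>r\<close> monotonicity of
  \<phi> preserves the inequality. If \<open>s < r\<close>, then \<open>x r = y r\<close>, so both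
  points undergo the same translation or none.\<close>

lemma lex_at_ball_shift:
  assumes "strict_mono \<phi>" "r \<in> S" "lex_at S s x y"
  shows "lex_at S s (ball_shift S a b r \<phi> x) (ball_shift S a b r \<phi> y)"
proof -
  have L: "s \<in> S" "x s < y s" "\<And>t. t \<in> S \<Longrightarrow> s < t \<Longrightarrow> x t = y t"
    using assms(3) unfolding lex_at_def by auto
  have above: "ball_shift S a b r \<phi> z t = z t" if "t \<in> S" "r < t" for z t
    using that by (simp add: ball_shift_def)
  show ?thesis
  proof (cases "r < s")
    case True
    then show ?thesis using L above unfolding lex_at_def by auto
  next
    case False
    \<comment> \<open>As \<open>s \<le> r\<close>, the two points agree above \<open>r\<close>, so
      both lie in the ball or neither does.\<close>
    have same: "(\<forall>t\<in>S. r < t \<longrightarrow> x t = a t) \<longleftrightarrow> (\<forall>t\<in>S. r < t \<longrightarrow> y t = a t)"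
      using L(3) False by (metis not_less order_le_less_trans)
    show ?thesis
    proof (cases "\<forall>t\<in>S. r < t \<longrightarrow> x t = a t")
      case notin: False
      then have "\<not> (\<forall>t\<in>S. r < t \<longrightarrow> y t = a t)" using same by blast
      then have "ball_shift S a b r \<phi> x = x" "ball_shift S a b r \<phi> y = y"
        using notin by (blast intro: ball_shift_outside)+
      then show ?thesis using assms(3) by simp
    next
      case True
      then have eq: "ball_shift S a b r \<phi> z t = (if r < t then z t
                    else if t = r then \<phi> (z r)
                    else if z r = a r then z t + (b t - a t) else z t)"
        if "z = x \<or> z = y" "t \<in> S" for z t
        using that same unfolding ball_shift_def by auto
      show ?thesis
      proof (cases "s = r")
        case True
        then show ?thesis
          using L assms(1) unfolding lex_at_def by (auto simp: eq strict_mono_less)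
      next
        case sr: False
        then have "x r = y r" using False L(3) assms(2) by auto
        then show ?thesis using L False sr unfolding lex_at_def by (auto simp: eq)
      qed
    qed
  qed
qed

text \<open>The balls around \<open>a\<close> and \<open>b\<close> coincide because these agree
  above \<open>r\<close>. Injectivity of \<phi> turns \<open>x r = a r\<close> into the
  corresponding condition for \<open>b\<close> on the image, so exactly the translated points are
  translated back.\<close>

lemma ball_shift_inverse:
  assumes "x \<in> QS S" "r \<in> S" and agree: "\<forall>t\<in>S. r < t \<longrightarrow> a t = b t"
    and "strict_mono \<phi>" "\<And>v. \<psi> (\<phi> v) = v" "\<phi> (a r) = b r"
  shows "ball_shift S b a r \<psi> (ball_shift S a b r \<phi> x) = x"
proof (cases "\<forall>t\<in>S. r < t \<longrightarrow> x t = a t")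
  case False
  then have "\<not> (\<forall>t\<in>S. r < t \<longrightarrow> x t = b t)" using agree by metis
  moreover have "ball_shift S a b r \<phi> x = x" using False by (rule ball_shift_outside)
  ultimately show ?thesis using ball_shift_outside by metis
next
  case True
  define y where "y = ball_shift S a b r \<phi> x"
  have y: "y t = (if r < t then x t else if t = r then \<phi> (x r)
                  else if x r = a r then x t + (b t - a t) else x t)" if "t \<in> S" for t
    using True that unfolding y_def ball_shift_def by simp
  have yb: "\<forall>t\<in>S. r < t \<longrightarrow> y t = b t" using True agree by (simp add: y)
  have yr: "y r = b r \<longleftrightarrow> x r = a r"
    using assms(2,4,6) by (simp add: y) (metis strict_mono_eq)
  have "ball_shift S b a r \<psi> y s = x s" for s
  proof (cases "s \<in> S")
    case True
    then show ?thesis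
      using yb yr assms(2,5) unfolding ball_shift_def by (simp add: y)
  next
    case False
    then show ?thesis using yb QS_outside[OF assms(1)] unfolding ball_shift_def by simp
  qed
  then show ?thesis unfolding y_def by blast
qed

section \<open>Automorphisms of \<open>QS S\<close> and extension of finite isometries\<close>

context
  fixes S :: "real set"
  assumes S_pos: "S \<subseteq> {0<..}"
begin

abbreviation QS_automorphism :: "((real \<Rightarrow> rat) \<Rightarrow> real \<Rightarrow> rat) \<Rightarrow> bool" where
  "QS_automorphism \<equiv> order_isometry (QS S) (QS_dist S) (QS_lex S) (QS S) (QS_dist S) (QS_lex S)"

text \<open>Monotonicity of \<phi> gives an order isometry onto the image; surjectivity comes from
  the shift with \<open>a\<close>, \<open>b\<close> and \<phi>, \<psi> exchanged.\<close>

lemma QS_automorphism_ball_shift: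
  assumes ab: "a \<in> QS S" "b \<in> QS S" and r: "r \<in> S" and agree: "\<forall>t\<in>S. r < t \<longrightarrow> a t = b t"
    and mono: "strict_mono \<phi>" "strict_mono \<psi>"
    and inv: "\<And>v. \<psi> (\<phi> v) = v" "\<And>v. \<phi> (\<psi> v) = v" and "\<phi> (a r) = b r"
  shows "QS_automorphism (ball_shift S a b r \<phi>)"
proof -
  have "QS S \<subseteq> ball_shift S a b r \<phi> ` QS S"
  proof
    fix y assume y: "y \<in> QS S"
    have "\<psi> (b r) = a r" using inv(1) assms(9) by metis
    then have "ball_shift S a b r \<phi> (ball_shift S b a r \<psi> y) = y"
      using agree by (intro ball_shift_inverse y r mono inv) auto
    then show "y \<in> ball_shift S a b r \<phi> ` QS S"
      using ball_shift_in_QS[OF y ab(2,1)] by (metis imageI)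
  qed
  then have "ball_shift S a b r \<phi> ` QS S = QS S"
    using ball_shift_in_QS ab by blast
  then show ?thesis
    using order_isometry_QSI[of "ball_shift S a b r \<phi>" "QS S" S] lex_at_ball_shift[OF mono(1) r]
    by auto
qed

lemma QS_automorphism_fixing:
  assumes ab: "a \<in> QS S" "b \<in> QS S" and C: "finite C" "C \<subseteq> QS S"
    and dist: "\<And>c. c \<in> C \<Longrightarrow> QS_dist S a c = QS_dist S b c"
    and lex: "\<And>c. c \<in> C \<Longrightarrow> QS_lex S c a \<longleftrightarrow> QS_lex S c b"
  obtains h where "QS_automorphism h" "h a = b" "\<And>c. c \<in> C \<Longrightarrow> h c = c"
proof (cases "a = b")
  case True
  have "QS_automorphism id" by (auto simp: order_isometry_def)
  then show ?thesis using that[of id] True by simp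
next
  case False
  define r where "r = QS_dist S a b"
  have r: "r \<in> S" "0 < r" "a r \<noteq> b r"
    using QS_dist_pos[OF S_pos ab False] unfolding r_def by auto
  have agree: "\<forall>t\<in>S. r < t \<longrightarrow> a t = b t"
    using QS_dist_le_iff[OF S_pos ab, of r] r by (simp add: r_def)
  \<comment> \<open>The points of \<open>C\<close> inside the ball being moved; the shift fixes all
    others.\<close>
  define P where "P = {c \<in> C. \<forall>t\<in>S. r < t \<longrightarrow> c t = a t}"
  have P: "a r \<noteq> c r \<and> b r \<noteq> c r \<and> (c r < a r \<longleftrightarrow> c r < b r)" if "c \<in> P" for c
  proof -
    have c: "c \<in> QS S" "c \<in> C" using that C unfolding P_def by auto
    \<comment> \<open>If \<open>c\<close> were one of \<open>a\<close>, \<open>b\<close>, its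
      distance to the other would vanish too, forcing \<open>a = b\<close>.\<close>
    have ne: "a \<noteq> c" "b \<noteq> c"
      using dist[OF c(2)] QS_dist_pos(2)[OF S_pos] ab c False
      by (metis QS_dist_self less_irrefl)+
    have "QS_dist S a c \<le> r"
      using that r c ab unfolding P_def by (subst QS_dist_le_iff[OF S_pos]) auto
    \<comment> \<open>The equal distances from \<open>c\<close> to \<open>a\<close> and
      \<open>b\<close> are at most \<open>r\<close>, and the ultrametric inequality makes them at
      least \<open>r\<close>. So \<open>c\<close> is compared with both at the coordinate
      \<open>r\<close>.\<close>
    moreover have "r \<le> max (QS_dist S a c) (QS_dist S c b)"
      unfolding r_def by (rule QS_dist_ultra[OF S_pos ab(1) c(1) ab(2)])
    ultimately have d: "QS_dist S a c = r" "QS_dist S b c = r"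
      using dist[OF c(2)] QS_dist_commute[of S c b] by auto
    then show ?thesis
      using QS_dist_pos(3)[OF S_pos ab(1) c(1) ne(1)] QS_dist_pos(3)[OF S_pos ab(2) c(1) ne(2)]
        lex[OF c(2)] ne unfolding QS_lex_def by (simp add: QS_dist_commute[of S c])
  qed
  obtain \<phi> \<psi> where \<phi>: "strict_mono \<phi>" "strict_mono \<psi>" "\<And>x. \<psi> (\<phi> x) = x" "\<And>x. \<phi> (\<psi> x) = x"
    "\<phi> (a r) = b r" "\<And>p. p \<in> (\<lambda>c. c r) ` P \<Longrightarrow> \<phi> p = p"
  proof (rule rat_automorphism_fixing[of "(\<lambda>c. c r) ` P" "a r" "b r"])
    show "finite ((\<lambda>c. c r) ` P)" using C(1) unfolding P_def by auto
  qed (use P in auto)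
  show ?thesis
  proof (rule that)
    show "QS_automorphism (ball_shift S a b r \<phi>)"
      by (rule QS_automorphism_ball_shift[OF ab r(1) agree \<phi>(1-5)])
    show "ball_shift S a b r \<phi> a = b"
      using agree \<phi>(5) QS_outside[OF ab(2)] by (auto simp: ball_shift_def fun_eq_iff)
    show "ball_shift S a b r \<phi> c = c" if "c \<in> C" for c
    proof (cases "c \<in> P")
      case True
      \<comment> \<open>Here \<open>c r\<close> differs from \<open>a r\<close>, so there is no
        translation, and \<phi> fixes \<open>c r\<close>.\<close>
      then show ?thesis using P[OF True] \<phi>(6) QS_outside[of c S] that C(2)
        by (auto simp: ball_shift_def fun_eq_iff)
    next
      case False
      then show ?thesis using that unfolding P_def ball_shift_def by auto
    qed
  qed
qed

text \<open>Induction on the domain: an automorphism \<open>g\<close> extending \<open>f\<close> on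
  \<open>F\<close> is followed by one that moves \<open>g p\<close> to \<open>f p\<close> and fixes
  the values of \<open>f\<close> on \<open>F\<close>.\<close>

lemma ultrahomogeneous_QS: "ultrahomogeneous (QS S) (QS_dist S) (QS_lex S)"
proof -
  have "\<exists>g. QS_automorphism g \<and> (\<forall>x\<in>F. g x = f x)"
    if "finite F" "F \<subseteq> QS S" "f ` F \<subseteq> QS S"
      "\<forall>x\<in>F. \<forall>y\<in>F. QS_dist S (f x) (f y) = QS_dist S x y"
      "\<forall>x\<in>F. \<forall>y\<in>F. QS_lex S (f x) (f y) \<longleftrightarrow> QS_lex S x y" for F f
    using that
  proof (induction F rule: finite_induct)
    case empty
    have "QS_automorphism id" by (auto simp: order_isometry_def)
    then show ?case by blast
  next
    case (insert p F)
    then obtain g where g: "QS_automorphism g" "\<And>x. x \<in> F \<Longrightarrow> g x = f x" by auto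
    have gQ: "g x \<in> QS S" if "x \<in> QS S" for x
      using g(1) that unfolding order_isometry_def by (auto dest: bij_betwE)
    have gd: "QS_dist S (g x) (g y) = QS_dist S x y" "QS_lex S (g x) (g y) \<longleftrightarrow> QS_lex S x y"
      if "x \<in> QS S" "y \<in> QS S" for x y
      using g(1) that unfolding order_isometry_def by auto
    \<comment> \<open>Both \<open>f\<close> and \<open>g\<close> preserve distance and order and
      they agree on \<open>F\<close>, so \<open>g p\<close> and \<open>f p\<close> are related alike
      to each \<open>f x\<close> with \<open>x\<close> in \<open>F\<close>.\<close>
    obtain h where h: "QS_automorphism h" "h (g p) = f p" "\<And>c. c \<in> f ` F \<Longrightarrow> h c = c"
    proof (rule QS_automorphism_fixing[of "g p" "f p" "f ` F"])
      fix c assume "c \<in> f ` F"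
      then obtain x where x: "x \<in> F" "c = f x" "c = g x" using g(2) by auto
      then have QS: "x \<in> QS S" "p \<in> QS S" using insert.prems(1) by auto
      have "QS_dist S (f p) (f x) = QS_dist S p x" "QS_lex S (f x) (f p) \<longleftrightarrow> QS_lex S x p"
        using insert.prems(3,4) x(1) by auto
      then show "QS_dist S (g p) c = QS_dist S (f p) c" "QS_lex S c (g p) \<longleftrightarrow> QS_lex S c (f p)"
        using gd[OF QS] gd[OF QS(2,1)] x by metis+
    qed (use insert gQ in auto)
    have "QS_automorphism (h \<circ> g)" using order_isometry_trans g(1) h(1) .
    moreover have "\<forall>x\<in>insert p F. (h \<circ> g) x = f x" using h g(2) by auto
    ultimately show ?case by blast
  qed
  note ext = this
  show ?thesis unfolding ultrahomogeneous_def
  proof (intro allI impI)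
    fix F G f
    assume A: "F \<subseteq> QS S \<and> finite F \<and> G \<subseteq> QS S \<and> finite G \<and>
      order_isometry F (QS_dist S) (QS_lex S) G (QS_dist S) (QS_lex S) f"
    then show "\<exists>g. QS_automorphism g \<and> (\<forall>x\<in>F. g x = f x)"
      by (intro ext) (auto simp: order_isometry_def bij_betw_def)
  qed
qed

end

theorem theorem7:
  fixes S :: "real set"
  assumes "S \<subseteq> {0<..}" and "countable S"
  shows "ordered_ultrametric_space (QS S) (QS_dist S) (QS_lex S) \<and> countable (QS S) \<and>
    (\<forall>F. F \<subseteq> QS S \<and> finite F \<longrightarrow> in_Uc S F (QS_dist S) (QS_lex S)) \<and>
    (\<forall>(X :: 'a set) d lt. in_Uc S X d lt \<longrightarrow>
       (\<exists>F f. F \<subseteq> QS S \<and> finite F \<and>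
          order_isometry X d lt F (QS_dist S) (QS_lex S) f)) \<and>
    ultrahomogeneous (QS S) (QS_dist S) (QS_lex S)"
  using ordered_ultrametric_space_QS_subset[OF assms(1) subset_refl] countable_QS[OF assms(2)]
    in_Uc_QS_subset[OF assms(1)] universal_QS[OF assms(1)] ultrahomogeneous_QS[OF assms(1)]
  by blast

end
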